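(* Let $X$ and $Y$ be proper metric spaces equipped with modules $\mathcal H_X$ and $\mathcal H_Y$ (for instance ample ones; ampleness is not required), with $\mathcal H_X$ discrete, and let $T\colon\mathcal H_X\to\mathcal H_Y$ be a bounded operator. Then the following are equivalent: (1) ${\rm Ad}(T)$ preserves local compactness, i.e. $TtT^*$ is locally compact for every locally compact $t\in\mathcal B(\mathcal H_X)$; (2) the restriction of ${\rm Ad}(T)$ to $C^*_{\rm Roe}(\mathcal H_X)$ preserves local compactness, i.e. $TtT^*$ is locally compact for every $t\in C^*_{\rm Roe}(\mathcal H_X)$; (3) $T$ is quasi-proper.
   Context: A metric space is proper if all closed balls are compact. A subset is bounded if it has finite diameter; $D\subseteq X$ is coarsely dense if there is $R<\infty$ such that every point of $X$ is within distance $R$ of $D$. An $X$-module is a Hilbert space $\mathcal H_X$ with a unital Boolean algebra $\mathfrak A$ of subsets of $X$ (the measurable sets) and a map $A\mapsto 1_A$ from $\mathfrak A$ to projections in $\mathcal B(\mathcal H_X)$ with $1_{A\cap A'}=1_A1_{A'}$, $1_{A\sqcup A'}=1_A+1_{A'}$ for disjoint $A,A'$, $1_X=\mathrm{id}$, and such that for some $r\geq 0$ the subspaces $1_A(\mathcal H_X)$, with $A$ measurable of diameter $\le r$, span a dense subspace. It is discrete if there are $r\ge0$ and a partition $X=\bigsqcup_i A_i$ into measurable sets of diameter $\le r$ with $\sum_i 1_{A_i}=1$ strongly and such that $C\subseteq X$ is measurable whenever every $C\cap A_i$ is. It is ample if for some $r\ge 0$ the union of the measurable sets $A$ of diameter $\le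 r$ with $1_A$ of infinite rank is coarsely dense in $X$. Modules over $Y$ are defined in the same way. An operator $t\in\mathcal B(\mathcal H_X)$ has propagation at most $r$ if $1_{A'}t1_A=0$ for all measurable $A,A'$ with $d(a',a)>r$ for all $a\in A,a'\in A'$; it has finite propagation if this holds for some $r<\infty$. An operator $t$ on $\mathcal H_X$ (or on $\mathcal H_Y$) is locally compact if $t1_A$ and $1_At$ are compact for every bounded measurable $A$. $C^*_{\rm Roe}(\mathcal H_X)$ is the norm closure of the locally compact operators of finite propagation. ${\rm Ad}(T)(t)=TtT^*$. $T\colon\mathcal H_X\to\mathcal H_Y$ is quasi-proper if for every $\varepsilon>0$ and every bounded measurable $B\subseteq Y$ there is a bounded measurable $A\subseteq X$ with $\|T^*1_B-1_AT^*1_B\|\le\varepsilon$. *)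

theory Defs
  imports "HOL-Analysis.Analysis"
begin

text \<open>Complex Hilbert spaces. The real inner product is required to be the real part of the
  complex one, so that norm, metric and completeness are those of the underlying real Hilbert
  space; positive definiteness of \<open>cinner\<close> is inherited from \<^class>\<open>real_inner\<close>. The complex inner
  product is conjugate-linear in its first argument.\<close>

class chilbert_space = real_inner + complete_space +
  fixes scaleC :: "complex \<Rightarrow> 'a \<Rightarrow> 'a" (infixr "*\<^sub>C" 75)
    and cinner :: "'a \<Rightarrow> 'a \<Rightarrow> complex"
  assumes scaleC_add_right: "a *\<^sub>C (x + y) = a *\<^sub>C x + a *\<^sub>C y"
    and scaleC_add_left: "(a + b) *\<^sub>C x = a *\<^sub>C x + b *\<^sub>C x"
    and scaleC_scaleC: "a *\<^sub>C (b *\<^sub>C x) = (a * b) *\<^sub>C x"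
    and scaleR_scaleC: "r *\<^sub>R x = complex_of_real r *\<^sub>C x"
    and cinner_commute: "cinner x y = cnj (cinner y x)"
    and cinner_add_right: "cinner x (y + z) = cinner x y + cinner x z"
    and cinner_scaleC_right: "cinner x (a *\<^sub>C y) = a * cinner x y"
    and inner_eq_Re_cinner: "inner x y = Re (cinner x y)"

abbreviation cspan :: "'h::chilbert_space set \<Rightarrow> 'h set"
  where "cspan \<equiv> module.span scaleC"

text \<open>Bounded operators between complex Hilbert spaces are the complex-linear elements of the
  real Banach space of bounded real-linear maps; the two operator norms agree.\<close>

definition cblinop :: "('h::chilbert_space \<Rightarrow>\<^sub>L 'k::chilbert_space) \<Rightarrow> bool"
  where "cblinop T \<longleftrightarrow> (\<forall>c x. T (c *\<^sub>C x) = c *\<^sub>C T x)"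

text \<open>For complex-linear \<open>T\<close> the adjoint exists and is unique by the Riesz representation theorem.\<close>

definition cadjoint :: "('h::chilbert_space \<Rightarrow>\<^sub>L 'k::chilbert_space) \<Rightarrow> ('k \<Rightarrow>\<^sub>L 'h)"
  where "cadjoint T = (THE S :: 'k \<Rightarrow>\<^sub>L 'h. \<forall>x y. cinner (T x) y = cinner x (S y))"

definition is_projection :: "('h::chilbert_space \<Rightarrow>\<^sub>L 'h) \<Rightarrow> bool"
  where "is_projection p \<longleftrightarrow> cblinop p \<and> p o\<^sub>L p = p \<and> cadjoint p = p"

definition compact_operator :: "('h::chilbert_space \<Rightarrow>\<^sub>L 'k::chilbert_space) \<Rightarrow> bool"
  where "compact_operator T \<longleftrightarrow> cblinop T \<and> compact (closure (blinfun_apply T ` cball 0 1))"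

text \<open>\<^const>\<open>diameter\<close> is real-valued and meaningless on unbounded sets.\<close>

definition diam_le :: "'x::metric_space set \<Rightarrow> real \<Rightarrow> bool"
  where "diam_le A r \<longleftrightarrow> bounded A \<and> diameter A \<le> r"

text \<open>A module is given by the algebra \<open>\<AA>\<close> of measurable sets and the map
  \<open>\<phi>\<close> sending \<open>A\<close> to the projection \<open>1\<^sub>A\<close>. Values of \<open>\<phi>\<close> outside \<open>\<AA>\<close> are irrelevant.\<close>

definition metric_module ::
  "'x::metric_space set set \<Rightarrow> ('x set \<Rightarrow> 'h::chilbert_space \<Rightarrow>\<^sub>L 'h) \<Rightarrow> bool"
  where "metric_module \<AA> \<phi> \<longleftrightarrow>
    algebra UNIV \<AA> \<and>
    (\<forall>A\<in>\<AA>. is_projection (\<phi> A)) \<and>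
    (\<forall>A\<in>\<AA>. \<forall>A'\<in>\<AA>. \<phi> (A \<inter> A') = \<phi> A o\<^sub>L \<phi> A') \<and>
    (\<forall>A\<in>\<AA>. \<forall>A'\<in>\<AA>. A \<inter> A' = {} \<longrightarrow> \<phi> (A \<union> A') = \<phi> A + \<phi> A') \<and>
    \<phi> UNIV = id_blinfun \<and>
    (\<exists>r\<ge>0. closure (cspan (\<Union>A\<in>{A\<in>\<AA>. diam_le A r}. range (blinfun_apply (\<phi> A)))) = UNIV)"

definition discrete_module ::
  "'x::metric_space set set \<Rightarrow> ('x set \<Rightarrow> 'h::chilbert_space \<Rightarrow>\<^sub>L 'h) \<Rightarrow> bool"
  where "discrete_module \<AA> \<phi> \<longleftrightarrow>
    (\<exists>r\<ge>0. \<exists>\<P>. partition_on UNIV \<P> \<and> (\<forall>A\<in>\<P>. A \<in> \<AA> \<and> diam_le A r) \<and>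
       (\<forall>v. ((\<lambda>A. \<phi> A v) has_sum v) \<P>) \<and>
       (\<forall>C. (\<forall>A\<in>\<P>. C \<inter> A \<in> \<AA>) \<longrightarrow> C \<in> \<AA>))"

definition propagation_le ::
  "'x::metric_space set set \<Rightarrow> ('x set \<Rightarrow> 'h::chilbert_space \<Rightarrow>\<^sub>L 'h) \<Rightarrow> ('h \<Rightarrow>\<^sub>L 'h) \<Rightarrow> real \<Rightarrow> bool"
  where "propagation_le \<AA> \<phi> t r \<longleftrightarrow>
    (\<forall>A\<in>\<AA>. \<forall>A'\<in>\<AA>. (\<forall>a\<in>A. \<forall>a'\<in>A'. dist a' a > r) \<longrightarrow> \<phi> A' o\<^sub>L t o\<^sub>L \<phi> A = 0)"

definition finite_propagation ::
  "'x::metric_space set set \<Rightarrow> ('x set \<Rightarrow> 'h::chilbert_space \<Rightarrow>\<^sub>L 'h) \<Rightarrow> ('h \<Rightarrow>\<^sub>L 'h) \<Rightarrow> bool"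
  where "finite_propagation \<AA> \<phi> t \<longleftrightarrow> (\<exists>r. propagation_le \<AA> \<phi> t r)"

definition locally_compact_op ::
  "'x::metric_space set set \<Rightarrow> ('x set \<Rightarrow> 'h::chilbert_space \<Rightarrow>\<^sub>L 'h) \<Rightarrow> ('h \<Rightarrow>\<^sub>L 'h) \<Rightarrow> bool"
  where "locally_compact_op \<AA> \<phi> t \<longleftrightarrow> cblinop t \<and>
    (\<forall>A\<in>\<AA>. bounded A \<longrightarrow> compact_operator (t o\<^sub>L \<phi> A) \<and> compact_operator (\<phi> A o\<^sub>L t))"

definition Roe_algebra ::
  "'x::metric_space set set \<Rightarrow> ('x set \<Rightarrow> 'h::chilbert_space \<Rightarrow>\<^sub>L 'h) \<Rightarrow> ('h \<Rightarrow>\<^sub>L 'h) set"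
  where "Roe_algebra \<AA> \<phi> = closure {t. locally_compact_op \<AA> \<phi> t \<and> finite_propagation \<AA> \<phi> t}"

definition Ad :: "('h::chilbert_space \<Rightarrow>\<^sub>L 'k::chilbert_space) \<Rightarrow> ('h \<Rightarrow>\<^sub>L 'h) \<Rightarrow> ('k \<Rightarrow>\<^sub>L 'k)"
  where "Ad T t = T o\<^sub>L t o\<^sub>L cadjoint T"

definition quasi_proper ::
  "'x::metric_space set set \<Rightarrow> ('x set \<Rightarrow> 'h::chilbert_space \<Rightarrow>\<^sub>L 'h) \<Rightarrow>
   'y::metric_space set set \<Rightarrow> ('y set \<Rightarrow> 'k::chilbert_space \<Rightarrow>\<^sub>L 'k) \<Rightarrow> ('h \<Rightarrow>\<^sub>L 'k) \<Rightarrow> bool"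
  where "quasi_proper \<AA> \<phi> \<BB> \<psi> T \<longleftrightarrow>
    (\<forall>\<epsilon>>0. \<forall>B\<in>\<BB>. bounded B \<longrightarrow> (\<exists>A\<in>\<AA>. bounded A \<and>
       norm ((cadjoint T o\<^sub>L \<psi> B) - (\<phi> A o\<^sub>L cadjoint T o\<^sub>L \<psi> B)) \<le> \<epsilon>))"

end

theory Submission
  imports Defs
begin

text \<open>If \<open>T\<close> is quasi-proper then \<open>T\<^sup>* 1\<^sub>B\<close> is a norm limit of operators \<open>1\<^sub>A T\<^sup>* 1\<^sub>B\<close> with \<open>A\<close> bounded,
  so \<open>T t T\<^sup>* 1\<^sub>B\<close> is a norm limit of operators \<open>T (t 1\<^sub>A) T\<^sup>* 1\<^sub>B\<close>, which are compact for locally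
  compact \<open>t\<close>; the other side follows by taking adjoints. Conversely, if \<open>T\<close> is not quasi-proper,
  some \<open>T\<^sup>* 1\<^sub>B\<close> maps unit vectors \<open>w\<^sub>n\<close> to vectors with a definite part of their mass on finite unions
  \<open>G\<^sub>n\<close> of pieces of the discrete partition, where the \<open>G\<^sub>n\<close> are disjoint and escape to infinity. Project
  in every piece onto the component of the relevant \<open>T\<^sup>* 1\<^sub>B w\<^sub>n\<close>. The resulting block-diagonal
  projection \<open>t\<close> is locally of finite rank and its propagation is at most the diameter of the pieces,
  so it lies in the Roe algebra, whereas \<open>(t T\<^sup>* 1\<^sub>B)\<^sup>* (t T\<^sup>* 1\<^sub>B) = 1\<^sub>B T t T\<^sup>* 1\<^sub>B\<close> is not compact.\<close>

section \<open>Complex Hilbert spaces\<close>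

lemma scaleC_zero_left [simp]: "0 *\<^sub>C (x::'h::chilbert_space) = 0"
  using scaleC_add_left[of 0 0 x] by simp

lemma scaleC_zero_right [simp]: "a *\<^sub>C (0::'h::chilbert_space) = 0"
  using scaleC_add_right[of a 0 "0::'h"] by simp

lemma scaleC_scaleR: "a *\<^sub>C (s *\<^sub>R x) = s *\<^sub>R (a *\<^sub>C (x::'h::chilbert_space))"
  by (simp add: scaleR_scaleC scaleC_scaleC mult.commute)

lemma cinner_scaleC_left: "cinner (a *\<^sub>C x) y = cnj a * cinner x (y::'h::chilbert_space)"
  by (metis cinner_commute cinner_scaleC_right complex_cnj_mult)

lemma inner_scaleC_left: "inner (a *\<^sub>C x) y = inner x (cnj a *\<^sub>C (y::'h::chilbert_space))"
  by (simp add: inner_eq_Re_cinner cinner_scaleC_left cinner_scaleC_right)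

text \<open>Conjugate linearity turns \<open>\<i>\<close> in the first slot into the factor
  \<open>- \<i>\<close>, so the real part becomes the imaginary part. Complex identities thus reduce
  to real ones.\<close>

lemma cinner_eq_Complex_inner:
  "cinner x y = Complex (inner x y) (inner (\<i> *\<^sub>C x) (y::'h::chilbert_space))"
  by (simp add: complex_eq_iff inner_eq_Re_cinner cinner_scaleC_left)

text \<open>Moving \<open>a\<close> across the inner product produces \<open>cnj a * a\<close>, the
  square of its modulus.\<close>

lemma norm_scaleC: "norm (a *\<^sub>C x) = cmod a * norm (x::'h::chilbert_space)"
proof -
  have "inner (a *\<^sub>C x) (a *\<^sub>C x) = (cmod a)\<^sup>2 * inner x x"
    by (simp add: inner_scaleC_left scaleC_scaleC complex_norm_square[symmetric] mult.commute
        flip: scaleR_scaleC of_real_power)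
  then have "(norm (a *\<^sub>C x))\<^sup>2 = (cmod a * norm x)\<^sup>2"
    by (simp add: power2_norm_eq_inner power_mult_distrib)
  then show ?thesis by (simp add: power2_eq_iff_nonneg)
qed

lemma bounded_linear_scaleC_right: "bounded_linear (\<lambda>x::'h::chilbert_space. a *\<^sub>C x)"
  by (rule bounded_linear_intro[where K="cmod a"])
     (simp_all add: scaleC_add_right scaleC_scaleR norm_scaleC)

lemma bounded_linear_scaleC_left: "bounded_linear (\<lambda>a. a *\<^sub>C (x::'h::chilbert_space))"
  by (rule bounded_linear_intro[where K="norm x"])
     (simp_all add: scaleC_add_left norm_scaleC scaleR_scaleC scaleC_scaleC scaleR_conv_of_real)

text \<open>\<open>subspace\<close> concerns real scalars; closure under complex ones makes the
  orthogonal projection complex linear.\<close>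

definition csubspace :: "'h::chilbert_space set \<Rightarrow> bool"
  where "csubspace M \<longleftrightarrow> 0 \<in> M \<and> (\<forall>x\<in>M. \<forall>y\<in>M. x + y \<in> M) \<and> (\<forall>a. \<forall>x\<in>M. a *\<^sub>C x \<in> M)"

lemma csubspace_imp_subspace: "csubspace M \<Longrightarrow> subspace M"
  by (auto simp: csubspace_def subspace_def scaleR_scaleC)

lemma csubspace_line: "csubspace (range (\<lambda>a. a *\<^sub>C (v::'h::chilbert_space)))"
  unfolding csubspace_def
  by (auto simp flip: scaleC_add_left intro: range_eqI[where x=0])
     (auto simp: scaleC_scaleC)

text \<open>For \<open>v \<noteq> 0\<close> the parametrisation scales distances by
  \<open>norm v\<close>, so the line inherits completeness from the complex plane.\<close>

lemma closed_line: "closed (range (\<lambda>a. a *\<^sub>C (v::'h::chilbert_space)))"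
proof (cases "v = 0")
  case True
  then have "range (\<lambda>a. a *\<^sub>C v) = {0}" by auto
  then show ?thesis by simp
next
  case False
  have "complete (range (\<lambda>a. a *\<^sub>C v))"
    by (rule complete_isometric_image[where e="norm v" and s=UNIV])
       (use False in \<open>auto simp: norm_scaleC bounded_linear_scaleC_left complete_UNIV\<close>)
  then show ?thesis by (rule complete_imp_closed)
qed

text \<open>Heine-Borel in one complex dimension: for \<open>v \<noteq> 0\<close> the set is the
  image of a compact disc.\<close>

lemma compact_bounded_line:
  "compact {x \<in> range (\<lambda>a. a *\<^sub>C (v::'h::chilbert_space)). norm x \<le> K}"
proof (cases "v = 0")
  case True
  then have "{x \<in> range (\<lambda>a. a *\<^sub>C v). norm x \<le> K} \<subseteq> {0}" by auto
  then show ?thesis by (meson finite.emptyI finite.insertI finite_subset finite_imp_compact)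
next
  case False
  have "{x \<in> range (\<lambda>a. a *\<^sub>C v). norm x \<le> K} = (\<lambda>a. a *\<^sub>C v) ` cball 0 (K / norm v)"
    using False by (auto simp: norm_scaleC field_simps)
  then show ?thesis
    by (metis bounded_linear_scaleC_left compact_cball compact_continuous_image
        linear_continuous_on)
qed

text \<open>The representing vector minimises \<open>\<parallel>x\<parallel>\<^sup>2 - 2 f x\<close> over \<open>M\<close>; minimising sequences are Cauchy
  by the parallelogram law.\<close>

lemma functional_represented_on_closed_subspace:
  fixes f :: "'h::{real_inner,complete_space} \<Rightarrow> real"
  assumes f: "bounded_linear f" and M: "subspace M" "closed M"
  shows "\<exists>z\<in>M. \<forall>x\<in>M. inner z x = f x"
proof -
  interpret f: bounded_linear f by fact
  obtain K where K: "\<And>x. norm (f x) \<le> norm x * K" using f.bounded by blast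
  define J where "J x = inner x x - 2 * f x" for x
  have J_lower: "- K\<^sup>2 \<le> J x" for x
  proof -
    have "f x \<le> norm x * K" using K[of x] by simp
    moreover have "0 \<le> (norm x - K)\<^sup>2" by simp
    ultimately show ?thesis
      by (simp add: J_def power2_diff power2_norm_eq_inner)
  qed
  define m where "m = Inf (J ` M)"
  have M0: "0 \<in> M" using M(1) by (simp add: subspace_0)
  have bdd: "bdd_below (J ` M)" using J_lower by (intro bdd_belowI2)
  have m_le: "m \<le> J x" if "x \<in> M" for x
    unfolding m_def using that bdd by (intro cInf_lower) auto
  have "\<exists>x\<in>M. J x < m + 1 / real (Suc n)" for n
  proof -
    have "Inf (J ` M) < m + 1 / real (Suc n)" by (simp add: m_def)
    then show ?thesis using M0 bdd by (subst (asm) cInf_less_iff) auto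
  qed
  then obtain X where XM: "\<And>n. X n \<in> M" and XJ: "\<And>n. J (X n) < m + 1 / real (Suc n)"
    by metis
  \<comment> \<open>In \<open>2 * J x + 2 * J y\<close> minus four times \<open>J\<close> at the
    midpoint the linear parts cancel and the parallelogram law applies; the midpoint value is at
    least \<open>m\<close>.\<close>
  have par: "(norm (x - y))\<^sup>2 \<le> 2 * (J x - m) + 2 * (J y - m)" if "x \<in> M" "y \<in> M" for x y
  proof -
    have "(1/2) *\<^sub>R (x + y) \<in> M" using that M(1) by (simp add: subspace_add subspace_scale)
    from m_le[OF this] show ?thesis
      by (simp add: J_def f.scaleR f.add power2_norm_eq_inner algebra_simps inner_commute)
  qed
  have "Cauchy X"
  proof (rule metric_CauchyI)
    fix e :: real assume "e > 0"
    then obtain N where N: "1 / real (Suc N) < e\<^sup>2 / 4"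
      using nat_approx_posE[of "e\<^sup>2 / 4"] by auto
    have "dist (X i) (X j) < e" if "i \<ge> N" "j \<ge> N" for i j
    proof -
      have "1 / real (Suc i) \<le> 1 / real (Suc N)" "1 / real (Suc j) \<le> 1 / real (Suc N)"
        using that by (auto intro!: divide_left_mono)
      then have "J (X i) - m < e\<^sup>2 / 4" "J (X j) - m < e\<^sup>2 / 4"
        using XJ[of i] XJ[of j] N by linarith+
      then have "(norm (X i - X j))\<^sup>2 < e\<^sup>2"
        using par[OF XM XM, of i j] by argo
      then show ?thesis using \<open>e > 0\<close> by (simp add: dist_norm power2_less_imp_less)
    qed
    then show "\<exists>N. \<forall>i\<ge>N. \<forall>j\<ge>N. dist (X i) (X j) < e" by blast
  qed
  then obtain z where z: "X \<longlonglongrightarrow> z" using Cauchy_convergent convergent_def by blast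
  have zM: "z \<in> M" using M(2) XM z closed_sequentially by blast
  have "(\<lambda>n. J (X n)) \<longlonglongrightarrow> J z"
    unfolding J_def by (intro tendsto_intros f.tendsto z)
  moreover have "(\<lambda>n. m + 1 / real (Suc n)) \<longlonglongrightarrow> m + 0"
    by (intro tendsto_add tendsto_const LIMSEQ_Suc[OF lim_1_over_n])
  ultimately have "J z \<le> m + 0"
    by (rule LIMSEQ_le) (use XJ less_imp_le in blast)
  then have Jz: "J z \<le> m" by simp
  have "inner z x = f x" if x: "x \<in> M" for x
  proof -
    define b where "b = inner z x - f x"
    \<comment> \<open>First variation at the minimiser \<open>z\<close> in the direction
      \<open>x\<close>: a nonnegative quadratic in \<open>s\<close> without constant term has zero
      linear coefficient.\<close>
    have b: "0 \<le> 2 * s * b + s\<^sup>2 * inner x x" for s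
    proof -
      have "z + s *\<^sub>R x \<in> M" using x zM M(1) by (simp add: subspace_add subspace_scale)
      from m_le[OF this] Jz have "J z \<le> J (z + s *\<^sub>R x)" by linarith
      then show ?thesis
        by (simp add: J_def b_def f.scaleR f.add inner_commute power2_eq_square algebra_simps)
    qed
    have "b = 0"
    proof (cases "inner x x = 0")
      case True
      with b[of "-b"] show ?thesis by (simp add: not_less[symmetric])
    next
      case False
      then have pos: "inner x x > 0" by (simp add: less_le)
      have "2 * (- (b / inner x x)) * b + (- (b / inner x x))\<^sup>2 * inner x x = - (b\<^sup>2 / inner x x)"
        using False by (simp add: power2_eq_square field_simps)
      then have "0 \<le> - (b\<^sup>2 / inner x x)" using b[of "- (b / inner x x)"] by (simp only:)
      then show ?thesis using pos by (simp add: divide_le_0_iff)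
    qed
    then show ?thesis by (simp add: b_def)
  qed
  with zM show ?thesis by blast
qed

section \<open>Adjoints of complex-linear operators\<close>

lemma cblinop_scaleC: "cblinop T \<Longrightarrow> T (a *\<^sub>C x) = a *\<^sub>C T x"
  by (simp add: cblinop_def)

lemma inner_eq_imp_eq: "(\<And>x. inner x y = inner x z) \<Longrightarrow> y = (z::'h::real_inner)"
  using vector_eq_ldot[of y z] by simp

text \<open>Riesz representation gives a real adjoint \<open>S\<close>; complex linearity of
  \<open>T\<close> makes it an adjoint for \<open>cinner\<close>. Uniqueness is proved too, because
  \<open>cadjoint\<close> is a definite description.\<close>

lemma cinner_cadjoint:
  fixes T :: "'h::chilbert_space \<Rightarrow>\<^sub>L 'k::chilbert_space"
  assumes T: "cblinop T"
  shows "cinner (T x) y = cinner x (cadjoint T y)"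
proof -
  have "\<exists>z. \<forall>x. inner z x = inner (T x) y" for y
  proof -
    have "bounded_linear (\<lambda>x. inner (T x) y)"
      by (rule bounded_linear_compose[OF bounded_linear_inner_left blinfun.bounded_linear_right])
    from functional_represented_on_closed_subspace[OF this subspace_UNIV closed_UNIV]
    show ?thesis by auto
  qed
  then obtain S where S: "\<And>x y. inner (S y) x = inner (T x) y" by metis
  have "bounded_linear S"
  proof (rule bounded_linear_intro[where K="norm T"])
    show "S (x + y) = S x + S y" for x y
      by (rule inner_eq_imp_eq) (simp add: S inner_commute[of _ "S _"] inner_simps)
    show "S (s *\<^sub>R x) = s *\<^sub>R S x" for s x
      by (rule inner_eq_imp_eq) (simp add: S inner_commute[of _ "S _"] inner_simps)
    show "norm (S y) \<le> norm y * norm T" for y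
    proof (cases "S y = 0")
      case False
      have "norm (S y) * norm (S y) = inner (T (S y)) y"
        by (simp flip: S power2_norm_eq_inner power2_eq_square)
      also have "\<dots> \<le> norm (T (S y)) * norm y" by (rule norm_cauchy_schwarz)
      also have "\<dots> \<le> norm T * norm (S y) * norm y"
        by (intro mult_right_mono norm_blinfun) auto
      finally have "norm (S y) * norm (S y) \<le> (norm y * norm T) * norm (S y)"
        by (simp add: mult_ac)
      then show ?thesis using False by simp
    qed simp
  qed
  then have app: "blinfun_apply (Blinfun S) = S" by (rule bounded_linear_Blinfun_apply)
  have "cinner (T x) y = cinner x (Blinfun S y)" for x y
    by (simp add: app cinner_eq_Complex_inner inner_commute[of _ "S _"] S
        cblinop_scaleC[OF T, symmetric])
  moreover have "R = Blinfun S" if "\<forall>x y. cinner (T x) y = cinner x (R y)" for R :: "'k \<Rightarrow>\<^sub>L 'h"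
  proof (rule blinfun_eqI, rule inner_eq_imp_eq)
    fix y x
    have "inner x (R y) = inner (T x) y" using that by (simp add: inner_eq_Re_cinner)
    also have "\<dots> = inner x (Blinfun S y)" by (simp add: app inner_commute[of x] S)
    finally show "inner x (R y) = inner x (Blinfun S y)" .
  qed
  ultimately have "cadjoint T = Blinfun S"
    unfolding cadjoint_def by (intro the_equality) blast+
  then show ?thesis using \<open>\<And>x y. cinner (T x) y = cinner x (Blinfun S y)\<close> by simp
qed

lemma inner_cadjoint: "cblinop T \<Longrightarrow> inner (T x) y = inner x (cadjoint T y)"
  by (simp add: inner_eq_Re_cinner cinner_cadjoint)

lemma cblinop_cadjoint:
  assumes T: "cblinop T"
  shows "cblinop (cadjoint T)"
  unfolding cblinop_def
proof (intro allI, rule inner_eq_imp_eq)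
  fix a x y
  have "cinner y (cadjoint T (a *\<^sub>C x)) = cinner y (a *\<^sub>C cadjoint T x)"
    by (simp only: cinner_cadjoint[OF T, symmetric] cinner_scaleC_right)
  then show "inner y (cadjoint T (a *\<^sub>C x)) = inner y (a *\<^sub>C cadjoint T x)"
    by (simp only: inner_eq_Re_cinner)
qed

text \<open>Cauchy-Schwarz for \<open>inner x (S (R x))\<close>, the square of
  \<open>norm (R x)\<close>. It transfers norm estimates within an adjoint pair without computing a
  \<open>cadjoint\<close>.\<close>

lemma norm_le_of_inner_adjoint:
  fixes R :: "'h::real_inner \<Rightarrow>\<^sub>L 'k::real_inner" and S :: "'k \<Rightarrow>\<^sub>L 'h"
  assumes "\<And>x y. inner (R x) y = inner x (S y)"
  shows "norm R \<le> norm S"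
proof (rule norm_blinfun_bound)
  fix x
  show "norm (R x) \<le> norm S * norm x"
  proof (cases "R x = 0")
    case False
    have "norm (R x) * norm (R x) = inner x (S (R x))"
      by (simp flip: assms power2_norm_eq_inner power2_eq_square)
    also have "\<dots> \<le> norm x * norm (S (R x))" by (rule norm_cauchy_schwarz)
    also have "\<dots> \<le> norm x * (norm S * norm (R x))"
      by (intro mult_left_mono norm_blinfun) auto
    finally show ?thesis using False by (simp add: mult_ac)
  qed simp
qed simp

lemma cblinop_compose: "cblinop S \<Longrightarrow> cblinop T \<Longrightarrow> cblinop (S o\<^sub>L T)"
  by (simp add: cblinop_def)

section \<open>Orthogonal projections\<close>

lemma is_projectionD:
  assumes "is_projection p"
  shows "cblinop p" "p (p x) = p x" "inner (p x) y = inner x (p y)"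
proof -
  show c: "cblinop p" using assms by (simp add: is_projection_def)
  show "p (p x) = p x" using assms unfolding is_projection_def by (metis blinfun_apply_blinfun_compose)
  show "inner (p x) y = inner x (p y)"
    using assms inner_cadjoint[OF c] by (simp add: is_projection_def)
qed

lemma norm_projection_le:
  assumes "is_projection p"
  shows "norm (p x) \<le> norm x"
proof (cases "p x = 0")
  case False
  have "norm (p x) * norm (p x) = inner x (p x)"
    using is_projectionD[OF assms] by (metis power2_norm_eq_inner power2_eq_square)
  also have "\<dots> \<le> norm x * norm (p x)" by (rule norm_cauchy_schwarz)
  finally show ?thesis using False by simp
qed simp

text \<open>Symmetry for the real inner product suffices, since it already determines the adjoint of
  a complex-linear operator.\<close>

lemma is_projectionI:
  assumes c: "cblinop p" and idem: "\<And>x. p (p x) = p x"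
    and sym: "\<And>x y. inner (p x) y = inner x (p y)"
  shows "is_projection p"
proof -
  have "cadjoint p = p"
    by (rule blinfun_eqI, rule inner_eq_imp_eq) (simp add: sym flip: inner_cadjoint[OF c])
  then show ?thesis using c idem by (simp add: is_projection_def blinfun_eqI)
qed

text \<open>\<open>t w\<close> represents \<open>inner w\<close> on \<open>M\<close>. It is the only
  vector of \<open>M\<close> that does, and this yields idempotence and, as \<open>M\<close> is a
  complex subspace, complex linearity.\<close>

lemma ex_projection_onto:
  fixes M :: "'h::chilbert_space set"
  assumes M: "csubspace M" "closed M"
  shows "\<exists>p. is_projection p \<and> range (blinfun_apply p) = M"
proof -
  have sM: "subspace M" using M(1) by (rule csubspace_imp_subspace)
  have "\<exists>z\<in>M. \<forall>x\<in>M. inner z x = inner w x" for w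
    by (rule functional_represented_on_closed_subspace[OF bounded_linear_inner_right sM M(2)])
  then obtain t where tM: "\<And>w. t w \<in> M" and t: "\<And>w x. x \<in> M \<Longrightarrow> inner (t w) x = inner w x"
    by metis
  have uniq: "t w = z" if "z \<in> M" "\<And>x. x \<in> M \<Longrightarrow> inner z x = inner w x" for w z
  proof -
    have "t w - z \<in> M" using tM that(1) sM by (simp add: subspace_diff)
    then have "inner (t w - z) (t w - z) = 0" using t that(2) by (simp add: inner_diff_left)
    then show ?thesis by simp
  qed
  have t_id: "t x = x" if "x \<in> M" for x using that by (intro uniq) auto
  have bl: "bounded_linear t"
  proof (rule bounded_linear_intro[where K=1])
    show "t (x + y) = t x + t y" for x y
      using tM t by (intro uniq) (auto simp: inner_add_left subspace_add[OF sM])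
    show "t (s *\<^sub>R x) = s *\<^sub>R t x" for s x
      using tM t by (intro uniq) (auto simp: subspace_scale[OF sM])
    show "norm (t x) \<le> norm x * 1" for x
    proof (cases "t x = 0")
      case False
      have "norm (t x) * norm (t x) = inner x (t x)"
        using t[OF tM] by (metis power2_norm_eq_inner power2_eq_square)
      also have "\<dots> \<le> norm x * norm (t x)" by (rule norm_cauchy_schwarz)
      finally show ?thesis using False by simp
    qed simp
  qed
  have tC: "t (a *\<^sub>C x) = a *\<^sub>C t x" for a x
    using tM t M(1) by (intro uniq) (auto simp: csubspace_def inner_scaleC_left)
  have app: "blinfun_apply (Blinfun t) = t" using bl by (rule bounded_linear_Blinfun_apply)
  have "is_projection (Blinfun t)"
  proof (rule is_projectionI)
    show "cblinop (Blinfun t)" by (simp add: cblinop_def app tC)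
    show "Blinfun t (Blinfun t x) = Blinfun t x" for x by (simp add: app t_id tM)
    show "inner (Blinfun t x) y = inner x (Blinfun t y)" for x y
      unfolding app using t[OF tM, of x y] t[OF tM, of y x] by (simp add: inner_commute)
  qed
  moreover have "range (blinfun_apply (Blinfun t)) = M"
    using tM t_id by (auto simp: app) (metis rangeI)
  ultimately show ?thesis by blast
qed

text \<open>Invariance says \<open>t p t = p t\<close>; the left side is self-adjoint, so taking
  adjoints gives \<open>t p t = t p\<close>.\<close>

lemma projections_commute:
  assumes p: "is_projection p" and t: "is_projection t"
    and inv: "\<And>x. p (t x) \<in> range (blinfun_apply t)"
  shows "t (p x) = p (t x)"
proof (rule inner_eq_imp_eq)
  have tpt: "t (p (t y)) = p (t y)" for y
  proof -
    obtain z where "p (t y) = t z" using inv[of y] by (elim rangeE)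
    then show ?thesis using is_projectionD(2)[OF t] by simp
  qed
  fix y
  have "inner y (t (p x)) = inner (p (t y)) x"
    by (simp add: is_projectionD(3)[OF p] is_projectionD(3)[OF t])
  also have "\<dots> = inner (t (p (t y))) x" by (simp add: tpt)
  also have "\<dots> = inner y (t (p (t x)))"
    by (simp add: is_projectionD(3)[OF p] is_projectionD(3)[OF t])
  finally show "inner y (t (p x)) = inner y (p (t x))" by (simp add: tpt)
qed

section \<open>Compact operators\<close>

lemma compact_operatorI:
  assumes "cblinop T" "compact S" "blinfun_apply T ` cball 0 1 \<subseteq> S"
  shows "compact_operator T"
proof -
  let ?C = "closure (blinfun_apply T ` cball 0 1)"
  have "?C \<subseteq> S" using assms(2,3) by (intro closure_minimal compact_imp_closed)
  then have "S \<inter> ?C = ?C" by (rule inf_absorb2)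
  moreover have "compact (S \<inter> ?C)" by (rule compact_Int_closed[OF assms(2) closed_closure])
  ultimately show ?thesis using assms(1) by (simp add: compact_operator_def)
qed

lemma compact_operator_compose_left:
  assumes "cblinop S" "compact_operator T"
  shows "compact_operator (S o\<^sub>L T)"
proof (rule compact_operatorI)
  show "cblinop (S o\<^sub>L T)" using assms by (simp add: cblinop_compose compact_operator_def)
  show "compact (blinfun_apply S ` closure (blinfun_apply T ` cball 0 1))"
    using assms by (intro compact_continuous_image)
      (auto simp: compact_operator_def intro: linear_continuous_on blinfun.bounded_linear_right)
  show "blinfun_apply (S o\<^sub>L T) ` cball 0 1 \<subseteq> blinfun_apply S ` closure (blinfun_apply T ` cball 0 1)"
    using closure_subset by fastforce
qed

lemma compact_operator_compose_right:
  assumes "compact_operator T" "cblinop S"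
  shows "compact_operator (T o\<^sub>L S)"
proof (rule compact_operatorI)
  \<comment> \<open>\<open>S\<close> maps the unit ball into the ball of radius \<open>?c\<close>;
    the added 1 keeps \<open>?c\<close> positive when \<open>S\<close> is zero.\<close>
  let ?K = "closure (blinfun_apply T ` cball 0 1)" and ?c = "norm S + 1"
  show "cblinop (T o\<^sub>L S)" using assms by (simp add: cblinop_compose compact_operator_def)
  show "compact ((\<lambda>x. ?c *\<^sub>R x) ` ?K)"
    using assms by (intro compact_scaling) (simp add: compact_operator_def)
  have c: "?c > 0" by (simp add: add_nonneg_pos)
  show "blinfun_apply (T o\<^sub>L S) ` cball 0 1 \<subseteq> (\<lambda>x. ?c *\<^sub>R x) ` ?K"
  proof clarsimp
    fix x :: 'c assume "norm x \<le> 1"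
    then have "norm (S x) \<le> ?c"
      using norm_blinfun[of S x] mult_left_mono[of "norm x" 1 "norm S"] by simp
    then have "(1 / ?c) *\<^sub>R S x \<in> cball 0 1" using c by (simp add: field_simps)
    then have "T ((1 / ?c) *\<^sub>R S x) \<in> ?K" by (intro subsetD[OF closure_subset] imageI)
    moreover have "T (S x) = ?c *\<^sub>R T ((1 / ?c) *\<^sub>R S x)"
      unfolding blinfun.scaleR_right using c by simp
    ultimately show "T (S x) \<in> (\<lambda>x. ?c *\<^sub>R x) ` ?K" by blast
  qed
qed

lemma compact_operator_add:
  assumes "compact_operator S" "compact_operator T"
  shows "compact_operator (S + T)"
proof (rule compact_operatorI)
  let ?A = "closure (blinfun_apply S ` cball 0 1)" and ?B = "closure (blinfun_apply T ` cball 0 1)"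
  show "cblinop (S + T)"
    using assms by (simp add: compact_operator_def cblinop_def blinfun.add_left scaleC_add_right)
  have "compact ?A" "compact ?B" using assms by (simp_all add: compact_operator_def)
  then show "compact (\<Union>x\<in>?A. \<Union>y\<in>?B. {x + y})" by (rule compact_sums')
  show "blinfun_apply (S + T) ` cball 0 1 \<subseteq> (\<Union>x\<in>?A. \<Union>y\<in>?B. {x + y})"
  proof clarify
    fix x :: 'a assume "x \<in> cball 0 1"
    then have "S x \<in> ?A" "T x \<in> ?B" by (auto intro!: subsetD[OF closure_subset])
    then show "(S + T) x \<in> (\<Union>x\<in>?A. \<Union>y\<in>?B. {x + y})"
      unfolding blinfun.add_left by blast
  qed
qed

lemma compact_operator_zero: "compact_operator 0"
  by (rule compact_operatorI[where S="{0}"]) (auto simp: cblinop_def)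

lemma compact_operator_sum:
  "finite F \<Longrightarrow> (\<And>i. i \<in> F \<Longrightarrow> compact_operator (T i)) \<Longrightarrow> compact_operator (\<Sum>i\<in>F. T i)"
  by (induction F rule: finite_induct) (auto simp: compact_operator_zero compact_operator_add)

lemma compact_operator_line:
  assumes "cblinop T" "range (blinfun_apply T) \<subseteq> range (\<lambda>a. a *\<^sub>C v)"
  shows "compact_operator T"
proof (rule compact_operatorI[OF assms(1)])
  show "compact {x \<in> range (\<lambda>a. a *\<^sub>C v). norm x \<le> norm T}" by (rule compact_bounded_line)
  show "blinfun_apply T ` cball 0 1 \<subseteq> {x \<in> range (\<lambda>a. a *\<^sub>C v). norm x \<le> norm T}"
  proof clarify
    fix x :: 'a assume "x \<in> cball 0 1"
    then have "norm (T x) \<le> norm T"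
      using norm_blinfun[of T x] mult_left_mono[of "norm x" 1 "norm T"] by simp
    then show "T x \<in> range (\<lambda>a. a *\<^sub>C v) \<and> norm (T x) \<le> norm T" using assms(2) by blast
  qed
qed

text \<open>A finite net for the image of a nearby compact operator becomes, with larger balls, one
  for the image of \<open>T\<close>.\<close>

lemma compact_operator_limit:
  fixes T :: "'h::chilbert_space \<Rightarrow>\<^sub>L 'k::chilbert_space"
  assumes T: "cblinop T" and approx: "\<And>e. e > 0 \<Longrightarrow> \<exists>K. compact_operator K \<and> norm (T - K) \<le> e"
  shows "compact_operator T"
  unfolding compact_operator_def compact_eq_totally_bounded
proof (intro conjI allI impI T)
  show "complete (closure (blinfun_apply T ` cball 0 1))" by (simp add: complete_eq_closed)
  fix e :: real assume "e > 0"
  then obtain K where K: "compact_operator K" "norm (T - K) \<le> e / 3"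
    using approx[of "e / 3"] by auto
  then obtain k where k: "finite k" "closure (blinfun_apply K ` cball 0 1) \<subseteq> (\<Union>x\<in>k. ball x (e / 3))"
    using \<open>e > 0\<close> unfolding compact_operator_def compact_eq_totally_bounded
    by (metis divide_pos_pos zero_less_numeral)
  \<comment> \<open>With closed balls the finite union is closed and absorbs the closure; the radius
    still leaves room for open balls of radius \<open>e\<close>.\<close>
  have "blinfun_apply T ` cball 0 1 \<subseteq> (\<Union>x\<in>k. cball x (2 * e / 3))"
  proof clarify
    fix x :: 'h assume x: "x \<in> cball 0 1"
    then have "K x \<in> (\<Union>x\<in>k. ball x (e / 3))"
      by (intro subsetD[OF k(2)] subsetD[OF closure_subset] imageI)
    then obtain y where y: "y \<in> k" "dist y (K x) < e / 3" by auto
    have "dist (K x) (T x) = norm ((T - K) x)"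
      by (simp add: dist_norm norm_minus_commute blinfun.diff_left)
    also have "\<dots> \<le> norm (T - K) * norm x" by (rule norm_blinfun)
    also have "\<dots> \<le> e / 3 * 1" using x K(2) \<open>e > 0\<close> by (intro mult_mono) auto
    finally have "dist y (T x) \<le> 2 * e / 3" using y(2) dist_triangle[of y "T x" "K x"] by simp
    then show "T x \<in> (\<Union>x\<in>k. cball x (2 * e / 3))" using y(1) by auto
  qed
  then have "closure (blinfun_apply T ` cball 0 1) \<subseteq> (\<Union>x\<in>k. cball x (2 * e / 3))"
    using k(1) by (intro closure_minimal) auto
  also have "\<dots> \<subseteq> (\<Union>x\<in>k. ball x e)" using \<open>e > 0\<close> by (intro UN_mono) auto
  finally show "\<exists>k. finite k \<and> closure (blinfun_apply T ` cball 0 1) \<subseteq> (\<Union>x\<in>k. ball x e)"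
    using k(1) by blast
qed

text \<open>\<open>K\<close> is the Gram operator of \<open>R\<close>: for a difference
  \<open>d\<close> of two of the \<open>w n\<close>, the square of \<open>norm (R d)\<close> is
  \<open>inner d (K d)\<close>, at most \<open>2 * norm (K d)\<close>. So convergence of
  \<open>K (w n)\<close> along a subsequence makes \<open>R (w n)\<close> Cauchy along it.\<close>

lemma Cauchy_subseq_of_compact_gram:
  fixes R :: "'k::chilbert_space \<Rightarrow>\<^sub>L 'h::real_inner"
  assumes K: "compact_operator K" and gram: "\<And>x y. inner (R x) (R y) = inner x (K y)"
    and w: "\<And>n. norm (w n) \<le> 1"
  shows "\<exists>s. strict_mono (s :: nat \<Rightarrow> nat) \<and> Cauchy (\<lambda>n. R (w (s n)))"
proof -
  have "K (w n) \<in> closure (blinfun_apply K ` cball 0 1)" for n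
    using w by (intro subsetD[OF closure_subset] imageI) simp
  then obtain l s where s: "strict_mono s" and l: "((\<lambda>n. K (w n)) \<circ> s) \<longlonglongrightarrow> l"
    using K unfolding compact_operator_def compact_def by metis
  have "Cauchy (\<lambda>n. K (w (s n)))"
    using LIMSEQ_imp_Cauchy[OF l] by (simp add: o_def)
  have "Cauchy (\<lambda>n. R (w (s n)))"
  proof (rule metric_CauchyI)
    fix e :: real assume "e > 0"
    then obtain N where N: "\<And>i j. i \<ge> N \<Longrightarrow> j \<ge> N \<Longrightarrow> norm (K (w (s i)) - K (w (s j))) < e\<^sup>2 / 2"
      using \<open>Cauchy (\<lambda>n. K (w (s n)))\<close> unfolding Cauchy_def dist_norm
      by (metis half_gt_zero zero_less_power)
    have "dist (R (w (s i))) (R (w (s j))) < e" if "i \<ge> N" "j \<ge> N" for i j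
    proof -
      let ?d = "w (s i) - w (s j)"
      have "(norm (R ?d))\<^sup>2 = inner ?d (K ?d)" by (simp add: power2_norm_eq_inner gram)
      also have "\<dots> \<le> norm ?d * norm (K ?d)" by (rule norm_cauchy_schwarz)
      also have "\<dots> \<le> 2 * norm (K ?d)"
      proof (rule mult_right_mono)
        show "norm ?d \<le> 2"
          using norm_triangle_ineq4[of "w (s i)" "w (s j)"] w[of "s i"] w[of "s j"] by linarith
      qed simp
      also have "\<dots> < e\<^sup>2" using N[OF that] by (simp add: blinfun.diff_right)
      finally show ?thesis
        using \<open>e > 0\<close> by (simp add: dist_norm blinfun.diff_right power2_less_imp_less)
    qed
    then show "\<exists>N. \<forall>i\<ge>N. \<forall>j\<ge>N. dist (R (w (s i))) (R (w (s j))) < e" by blast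
  qed
  with s show ?thesis by blast
qed

lemma norm_blinfun_compose3: "norm (R o\<^sub>L (S o\<^sub>L T)) \<le> norm R * (norm S * norm T)"
  by (rule order_trans[OF norm_blinfun_compose mult_left_mono[OF norm_blinfun_compose norm_ge_zero]])

section \<open>Modules and quasi-proper operators\<close>

lemma metric_module_projection: "metric_module \<AA> \<phi> \<Longrightarrow> A \<in> \<AA> \<Longrightarrow> is_projection (\<phi> A)"
  by (simp add: metric_module_def)

lemma quasi_proper_imp_Ad_locally_compact:
  fixes T :: "'h::chilbert_space \<Rightarrow>\<^sub>L 'k::chilbert_space"
  assumes X: "metric_module \<AA> \<phi>" and Y: "metric_module \<BB> \<psi>" and T: "cblinop T"
    and qp: "quasi_proper \<AA> \<phi> \<BB> \<psi> T" and t: "locally_compact_op \<AA> \<phi> t"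
  shows "locally_compact_op \<BB> \<psi> (Ad T t)"
  unfolding locally_compact_op_def
proof (intro conjI ballI impI)
  have ct: "cblinop t" using t by (simp add: locally_compact_op_def)
  have cA: "cblinop (cadjoint T)" using T by (rule cblinop_cadjoint)
  show cAd: "cblinop (Ad T t)" unfolding Ad_def by (intro cblinop_compose T ct cA)
  fix B assume B: "B \<in> \<BB>" "bounded B"
  have pB: "is_projection (\<psi> B)" using metric_module_projection[OF Y] B by simp
  have cB: "cblinop (\<psi> B)" by (rule is_projectionD(1)[OF pB])
  \<comment> \<open>One constant majorises the factors in both estimates below; the added 1 makes it
    positive.\<close>
  define c where "c = norm T * norm t + norm t * norm (cadjoint T) + 1"
  have c: "c > 0" unfolding c_def by (intro add_nonneg_pos add_nonneg_nonneg) auto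
  have approx: "\<exists>K K'. compact_operator K \<and> norm ((Ad T t o\<^sub>L \<psi> B) - K) \<le> e \<and>
      compact_operator K' \<and> norm ((\<psi> B o\<^sub>L Ad T t) - K') \<le> e" if "e > 0" for e
  proof -
    from that c have "e / c > 0" by simp
    then obtain A where A: "A \<in> \<AA>" "bounded A"
      and le: "norm ((cadjoint T o\<^sub>L \<psi> B) - (\<phi> A o\<^sub>L cadjoint T o\<^sub>L \<psi> B)) \<le> e / c"
      using qp B unfolding quasi_proper_def by metis
    define S where "S = (cadjoint T o\<^sub>L \<psi> B) - (\<phi> A o\<^sub>L cadjoint T o\<^sub>L \<psi> B)"
    define R where "R = (\<psi> B o\<^sub>L T) - (\<psi> B o\<^sub>L T o\<^sub>L \<phi> A)"
    have pA: "is_projection (\<phi> A)" using metric_module_projection[OF X] A by simp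
    have S: "norm S \<le> e / c" using le by (simp add: S_def)
    \<comment> \<open>\<open>R\<close> is the adjoint of \<open>S\<close>, so the quasi-properness
      estimate also controls the cut-off of \<open>\<psi> B o\<^sub>L T\<close>.\<close>
    have "inner (R x) y = inner x (S y)" for x y
      by (simp add: R_def S_def blinfun.diff_left inner_diff_left inner_diff_right
          is_projectionD(3)[OF pA] is_projectionD(3)[OF pB] inner_cadjoint[OF T])
    then have "norm R \<le> norm S" by (rule norm_le_of_inner_adjoint)
    with S have R: "norm R \<le> e / c" by linarith
    have K: "compact_operator (t o\<^sub>L \<phi> A)" "compact_operator (\<phi> A o\<^sub>L t)"
      using t A by (auto simp: locally_compact_op_def)
    let ?K = "T o\<^sub>L ((t o\<^sub>L \<phi> A) o\<^sub>L (cadjoint T o\<^sub>L \<psi> B))"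
    let ?K' = "(\<psi> B o\<^sub>L T) o\<^sub>L ((\<phi> A o\<^sub>L t) o\<^sub>L cadjoint T)"
    have "(Ad T t o\<^sub>L \<psi> B) - ?K = T o\<^sub>L (t o\<^sub>L S)"
      by (rule blinfun_eqI) (simp add: Ad_def S_def blinfun.diff_left blinfun.diff_right)
    then have "norm ((Ad T t o\<^sub>L \<psi> B) - ?K) \<le> norm T * (norm t * norm S)" by (simp only: norm_blinfun_compose3)
    also have "\<dots> \<le> c * (e / c)"
      unfolding mult.assoc[symmetric]
      by (intro mult_mono S) (use c in \<open>auto simp: c_def\<close>)
    finally have 1: "norm ((Ad T t o\<^sub>L \<psi> B) - ?K) \<le> e" using c by simp
    have "(\<psi> B o\<^sub>L Ad T t) - ?K' = R o\<^sub>L (t o\<^sub>L cadjoint T)"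
      by (rule blinfun_eqI) (simp add: Ad_def R_def blinfun.diff_left blinfun.diff_right)
    then have "norm ((\<psi> B o\<^sub>L Ad T t) - ?K') \<le> norm R * (norm t * norm (cadjoint T))" by (simp only: norm_blinfun_compose3)
    also have "\<dots> \<le> (e / c) * c"
      by (intro mult_mono R) (use c that in \<open>auto simp: c_def\<close>)
    finally have 2: "norm ((\<psi> B o\<^sub>L Ad T t) - ?K') \<le> e" using c by simp
    have "compact_operator ?K" "compact_operator ?K'"
      by (intro compact_operator_compose_left compact_operator_compose_right K T cA cB cblinop_compose)+
    with 1 2 show ?thesis by blast
  qed
  show "compact_operator (Ad T t o\<^sub>L \<psi> B)"
    by (rule compact_operator_limit) (use approx in \<open>auto intro: cblinop_compose cAd cB\<close>)
  show "compact_operator (\<psi> B o\<^sub>L Ad T t)"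
    by (rule compact_operator_limit) (use approx in \<open>auto intro: cblinop_compose cAd cB\<close>)
qed

section \<open>The Roe algebra\<close>

lemma closed_cblinop: "closed {t :: 'h::chilbert_space \<Rightarrow>\<^sub>L 'k::chilbert_space. cblinop t}"
  unfolding cblinop_def
  by (intro closed_Collect_all closed_Collect_eq continuous_intros
      bounded_linear.continuous_on[OF bounded_linear_scaleC_right])

text \<open>Composition with the fixed operator \<open>\<phi> A\<close> is norm continuous, and norm
  limits of compact operators are compact.\<close>

lemma Roe_algebra_locally_compact:
  assumes X: "metric_module \<AA> \<phi>" and t: "t \<in> Roe_algebra \<AA> \<phi>"
  shows "locally_compact_op \<AA> \<phi> t"
  unfolding locally_compact_op_def
proof (intro conjI ballI impI)
  let ?S = "{t. locally_compact_op \<AA> \<phi> t \<and> finite_propagation \<AA> \<phi> t}"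
  \<comment> \<open>The closure is taken among real-linear maps, so complex linearity of the limit
    needs its own argument.\<close>
  have "closure ?S \<subseteq> {t. cblinop t}"
    by (rule closure_minimal[OF _ closed_cblinop]) (auto simp: locally_compact_op_def)
  then show ct: "cblinop t" using t by (auto simp: Roe_algebra_def)
  fix A assume A: "A \<in> \<AA>" "bounded A"
  have cA: "cblinop (\<phi> A)" using metric_module_projection[OF X] A is_projectionD(1) by blast
  have approx: "\<exists>K K'. compact_operator K \<and> norm ((t o\<^sub>L \<phi> A) - K) \<le> e \<and>
      compact_operator K' \<and> norm ((\<phi> A o\<^sub>L t) - K') \<le> e" if "e > 0" for e
  proof -
    have c: "norm (\<phi> A) + 1 > 0" by (simp add: add_nonneg_pos)
    then have "e / (norm (\<phi> A) + 1) > 0" using that by simp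
    then obtain s where s: "s \<in> ?S" "dist s t < e / (norm (\<phi> A) + 1)"
      using t unfolding Roe_algebra_def closure_approachable by blast
    have ts: "norm (t - s) \<le> e / (norm (\<phi> A) + 1)"
      using s(2) by (simp add: dist_norm norm_minus_commute)
    have le: "norm (t - s) * norm (\<phi> A) \<le> e"
    proof -
      have "norm (t - s) * norm (\<phi> A) \<le> e / (norm (\<phi> A) + 1) * (norm (\<phi> A) + 1)"
        by (intro mult_mono ts) (use that c in auto)
      then show ?thesis using c by simp
    qed
    have "(t o\<^sub>L \<phi> A) - (s o\<^sub>L \<phi> A) = (t - s) o\<^sub>L \<phi> A" "(\<phi> A o\<^sub>L t) - (\<phi> A o\<^sub>L s) = \<phi> A o\<^sub>L (t - s)"
      by (rule blinfun_eqI, simp add: blinfun.diff_left blinfun.diff_right)+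
    then have "norm ((t o\<^sub>L \<phi> A) - (s o\<^sub>L \<phi> A)) \<le> e" "norm ((\<phi> A o\<^sub>L t) - (\<phi> A o\<^sub>L s)) \<le> e"
      using norm_blinfun_compose[of "t - s" "\<phi> A"] norm_blinfun_compose[of "\<phi> A" "t - s"] le
      by (simp_all add: mult.commute)
    moreover have "compact_operator (s o\<^sub>L \<phi> A)" "compact_operator (\<phi> A o\<^sub>L s)"
      using s(1) A by (auto simp: locally_compact_op_def)
    ultimately show ?thesis by blast
  qed
  show "compact_operator (t o\<^sub>L \<phi> A)"
    by (rule compact_operator_limit) (use approx in \<open>auto intro: cblinop_compose ct cA\<close>)
  show "compact_operator (\<phi> A o\<^sub>L t)"
    by (rule compact_operator_limit) (use approx in \<open>auto intro: cblinop_compose ct cA\<close>)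
qed

section \<open>Discrete modules with a fixed partition into pieces\<close>

locale discrete_partition =
  fixes \<AA> :: "'x::metric_space set set"
    and \<phi> :: "'x set \<Rightarrow> 'h::chilbert_space \<Rightarrow>\<^sub>L 'h"
    and r :: real
    and \<P> :: "'x set set"
  assumes X: "metric_module \<AA> \<phi>"
    and partition: "partition_on UNIV \<P>"
    and piece_measurable: "P \<in> \<P> \<Longrightarrow> P \<in> \<AA>"
    and piece_diam: "P \<in> \<P> \<Longrightarrow> diam_le P r"
    and pieces_sum: "((\<lambda>P. \<phi> P v) has_sum v) \<P>"
    and measurable_if: "(\<And>P. P \<in> \<P> \<Longrightarrow> C \<inter> P \<in> \<AA>) \<Longrightarrow> C \<in> \<AA>"
begin

lemma algebra: "algebra UNIV \<AA>"
  using X by (simp add: metric_module_def)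

lemma empty_measurable: "{} \<in> \<AA>"
  using algebra by (simp add: algebra_iff_Un)

lemma proj: "A \<in> \<AA> \<Longrightarrow> is_projection (\<phi> A)"
  using X by (rule metric_module_projection)

lemma phi_Int: "A \<in> \<AA> \<Longrightarrow> A' \<in> \<AA> \<Longrightarrow> \<phi> A (\<phi> A' v) = \<phi> (A \<inter> A') v"
  using X by (simp add: metric_module_def)

lemma phi_empty: "\<phi> {} = 0"
proof -
  have "\<phi> ({} \<union> {}) = \<phi> {} + \<phi> {}"
    using X empty_measurable unfolding metric_module_def by blast
  then show ?thesis by simp
qed

lemma phi_disjoint: "A \<in> \<AA> \<Longrightarrow> A' \<in> \<AA> \<Longrightarrow> A \<inter> A' = {} \<Longrightarrow> \<phi> A (\<phi> A' v) = 0"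
  by (simp add: phi_Int phi_empty)

lemma phi_subset:
  assumes "A \<in> \<AA>" "A' \<in> \<AA>" "A \<subseteq> A'"
  shows "\<phi> A (\<phi> A' v) = \<phi> A v" "\<phi> A' (\<phi> A v) = \<phi> A v"
  using assms by (simp_all add: phi_Int Int_absorb1 Int_absorb2)

lemma pieces_disjoint: "P \<in> \<P> \<Longrightarrow> P' \<in> \<P> \<Longrightarrow> P \<noteq> P' \<Longrightarrow> P \<inter> P' = {}"
  using partition by (auto simp: partition_on_def disjoint_def)

lemma piece_nonempty: "P \<in> \<P> \<Longrightarrow> P \<noteq> {}"
  using partition by (auto simp: partition_on_def)

lemma ex_piece: "\<exists>P\<in>\<P>. x \<in> P"
  using partition by (auto simp: partition_on_def)

lemma piece_Int_Union:
  assumes "P \<in> \<P>" "Q \<subseteq> \<P>"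
  shows "P \<inter> \<Union>Q = (if P \<in> Q then P else {})"
proof (cases "P \<in> Q")
  case False
  then have "P \<inter> P' = {}" if "P' \<in> Q" for P'
    using pieces_disjoint[OF assms(1), of P'] that assms(2) by blast
  with False show ?thesis by auto
qed auto

text \<open>Such a union, even an infinite one, meets each piece in the whole piece or not at all,
  so the measurability condition of a discrete module applies.\<close>

lemma Union_measurable: "Q \<subseteq> \<P> \<Longrightarrow> \<Union>Q \<in> \<AA>"
  by (rule measurable_if)
     (simp add: Int_commute[of "\<Union>Q"] piece_Int_Union piece_measurable empty_measurable)

lemma phi_piece_Union:
  assumes "P \<in> \<P>" "Q \<subseteq> \<P>"
  shows "\<phi> P (\<phi> (\<Union>Q) v) = (if P \<in> Q then \<phi> P v else 0)"
  using phi_Int[OF piece_measurable[OF assms(1)] Union_measurable[OF assms(2)]]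
  by (simp add: piece_Int_Union[OF assms] phi_empty)

lemma eq_finite_sum_of_pieces:
  assumes F: "finite F" "F \<subseteq> \<P>" and 0: "\<And>P. P \<in> \<P> \<Longrightarrow> P \<notin> F \<Longrightarrow> \<phi> P v = 0"
  shows "v = (\<Sum>P\<in>F. \<phi> P v)"
proof -
  have "((\<lambda>P. \<phi> P v) has_sum v) F \<longleftrightarrow> ((\<lambda>P. \<phi> P v) has_sum v) \<P>"
    by (rule has_sum_cong_neutral) (use F 0 in auto)
  then have "((\<lambda>P. \<phi> P v) has_sum v) F" using pieces_sum by simp
  then show ?thesis using F(1) has_sum_finite[OF F(1)] has_sum_unique by blast
qed

text \<open>The union of \<open>star C\<close> is the smallest union of pieces containing
  \<open>C\<close>. The block projections built below commute with the projections of such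
  unions.\<close>

definition star :: "'x set \<Rightarrow> 'x set set"
  where "star C = {P \<in> \<P>. P \<inter> C \<noteq> {}}"

lemma star_subset: "star C \<subseteq> \<P>"
  by (auto simp: star_def)

lemma subset_Union_star: "C \<subseteq> \<Union>(star C)"
  using ex_piece by (force simp: star_def)

lemma dist_in_piece: "P \<in> \<P> \<Longrightarrow> x \<in> P \<Longrightarrow> y \<in> P \<Longrightarrow> dist x y \<le> r"
  using piece_diam[of P] diameter_bounded_bound[of P x y] by (simp add: diam_le_def)

text \<open>Every point of the union is within \<open>r\<close> of a point of \<open>C\<close>,
  because pieces have diameter at most \<open>r\<close>.\<close>

lemma bounded_Union_star:
  assumes "bounded C"
  shows "bounded (\<Union>(star C))"
proof -
  obtain x R where R: "\<And>y. y \<in> C \<Longrightarrow> dist x y \<le> R" using assms bounded_def by metis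
  have "dist x z \<le> R + r" if z: "z \<in> \<Union>(star C)" for z
  proof -
    obtain P y where "P \<in> \<P>" "z \<in> P" "y \<in> P" "y \<in> C"
      using z unfolding star_def by blast
    then show ?thesis using dist_triangle[of x z y] R[of y] dist_in_piece[of P y z] by linarith
  qed
  then show ?thesis unfolding bounded_def by blast
qed

lemma bounded_eventually_subset:
  assumes "bounded C" "\<And>n. cball x (real n) \<subseteq> D n"
  shows "\<exists>N. \<forall>n\<ge>N. C \<subseteq> D n"
proof -
  obtain R where R: "\<And>y. y \<in> C \<Longrightarrow> dist x y \<le> R" using assms(1) bounded_any_center[of C x] by blast
  have "C \<subseteq> D n" if "n \<ge> nat \<lceil>R\<rceil>" for n
  proof
    fix y assume "y \<in> C"
    then have "dist x y \<le> real n" using R[of y] that by linarith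
    then show "y \<in> D n" using assms(2)[of n] by auto
  qed
  then show ?thesis by blast
qed

text \<open>The projection onto the vectors whose component in each piece \<open>P\<close> is a multiple of \<open>v P\<close>:
  a block-diagonal sum of projections of rank at most one.\<close>

lemma block_rank_one_projection:
  assumes locfin: "\<And>C. bounded C \<Longrightarrow> finite {P \<in> star C. v P \<noteq> 0}"
  obtains t where "is_projection t" "locally_compact_op \<AA> \<phi> t" "propagation_le \<AA> \<phi> t r"
    "\<And>x. (\<And>P. P \<in> \<P> \<Longrightarrow> \<phi> P x \<in> range (\<lambda>a. a *\<^sub>C v P)) \<Longrightarrow> t x = x"
    "\<And>Q x. Q \<subseteq> \<P> \<Longrightarrow> t (\<phi> (\<Union>Q) x) = \<phi> (\<Union>Q) (t x)"
proof -
  define L where "L P = range (\<lambda>a. a *\<^sub>C v P)" for P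
  \<comment> \<open>An intersection of preimages of closed lines, hence a closed complex subspace;
    \<open>t\<close> will be the orthogonal projection onto it.\<close>
  define M where "M = (\<Inter>P\<in>\<P>. blinfun_apply (\<phi> P) -` L P)"
  have L: "csubspace (L P)" "closed (L P)" for P
    unfolding L_def by (rule csubspace_line closed_line)+
  have "csubspace M"
    using L(1) cblinop_scaleC[OF is_projectionD(1)[OF proj[OF piece_measurable]]]
    by (auto simp: M_def csubspace_def blinfun.add_right)
  moreover have "closed M"
    unfolding M_def
    by (intro closed_INT ballI closed_vimage L linear_continuous_on blinfun.bounded_linear_right)
  ultimately obtain t where t: "is_projection t" and tM: "range (blinfun_apply t) = M"
    using ex_projection_onto by blast
  have t_id: "t x = x" if "x \<in> M" for x
    using that is_projectionD(2)[OF t] unfolding tM[symmetric] by auto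
  \<comment> \<open>Cutting down to a union of pieces keeps or kills each component, so it preserves
    \<open>M\<close>.\<close>
  have comm: "t (\<phi> (\<Union>Q) x) = \<phi> (\<Union>Q) (t x)" if Q: "Q \<subseteq> \<P>" for Q x
  proof (rule projections_commute[OF proj[OF Union_measurable[OF Q]] t])
    fix y
    have "t y \<in> M" using tM by auto
    then show "\<phi> (\<Union>Q) (t y) \<in> range (blinfun_apply t)"
      unfolding tM using L(1) by (auto simp: M_def phi_piece_Union Q csubspace_def)
  qed
  have ct: "cblinop t" by (rule is_projectionD(1)[OF t])
  have phi_t: "\<phi> P (t x) \<in> L P" if "P \<in> \<P>" for P x
    using tM that by (auto simp: M_def)
  have piece: "compact_operator (\<phi> P o\<^sub>L t)" if "P \<in> \<P>" for P
    using phi_t[OF that] is_projectionD(1)[OF proj[OF piece_measurable[OF that]]]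
    by (intro compact_operator_line[where v="v P"] cblinop_compose ct) (auto simp: L_def)
  \<comment> \<open>Only finitely many pieces of the star have \<open>v P \<noteq> 0\<close>, so
    this is a finite sum of operators of rank at most one.\<close>
  have K: "compact_operator (\<phi> (\<Union>(star C)) o\<^sub>L t)" if "bounded C" for C
  proof -
    define F where "F = {P \<in> star C. v P \<noteq> 0}"
    have F: "finite F" "F \<subseteq> \<P>" "F \<subseteq> star C"
      using locfin[OF that] star_subset[of C] by (auto simp: F_def)
    have "\<phi> (\<Union>(star C)) (t x) = (\<Sum>P\<in>F. \<phi> P (t x))" for x
    proof -
      let ?z = "\<phi> (\<Union>(star C)) (t x)"
      have "\<phi> P ?z = 0" if "P \<in> \<P>" "P \<notin> F" for P
        using phi_t[OF that(1), of x] that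
        by (auto simp: phi_piece_Union star_subset F_def L_def)
      then have "?z = (\<Sum>P\<in>F. \<phi> P ?z)" by (intro eq_finite_sum_of_pieces F)
      also have "\<dots> = (\<Sum>P\<in>F. \<phi> P (t x))"
        by (intro sum.cong refl)
          (simp add: phi_piece_Union star_subset subsetD[OF F(2)] subsetD[OF F(3)])
      finally show ?thesis .
    qed
    then have "\<phi> (\<Union>(star C)) o\<^sub>L t = (\<Sum>P\<in>F. \<phi> P o\<^sub>L t)"
      by (intro blinfun_eqI) (simp add: blinfun.sum_left)
    then show ?thesis using F piece by (auto intro: compact_operator_sum)
  qed
  have phi_star: "\<phi> A (\<phi> (\<Union>(star A)) x) = \<phi> A x" "\<phi> (\<Union>(star A)) (\<phi> A x) = \<phi> A x"
    if "A \<in> \<AA>" for A x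
    using phi_subset[OF that Union_measurable[OF star_subset] subset_Union_star] .
  \<comment> \<open>\<open>\<phi> A\<close> lies under the projection of the union of its star,
    which commutes with \<open>t\<close>; so \<open>t\<close> spreads \<open>A\<close> no further
    than the pieces meeting it.\<close>
  have t_phi: "t (\<phi> A x) = \<phi> (\<Union>(star A)) (t (\<phi> A x))" if "A \<in> \<AA>" for A x
    using comm[OF star_subset, of A "\<phi> A x"] by (simp add: phi_star[OF that])
  have "locally_compact_op \<AA> \<phi> t"
    unfolding locally_compact_op_def
  proof (intro conjI ballI impI ct)
    fix A assume A: "A \<in> \<AA>" "bounded A"
    have cA: "cblinop (\<phi> A)" by (rule is_projectionD(1)[OF proj[OF A(1)]])
    have "t o\<^sub>L \<phi> A = (\<phi> (\<Union>(star A)) o\<^sub>L t) o\<^sub>L \<phi> A"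
      by (rule blinfun_eqI) (simp flip: t_phi[OF A(1)])
    then show "compact_operator (t o\<^sub>L \<phi> A)"
      using compact_operator_compose_right[OF K[OF A(2)] cA] by simp
    have "\<phi> A o\<^sub>L t = \<phi> A o\<^sub>L (\<phi> (\<Union>(star A)) o\<^sub>L t)"
      by (rule blinfun_eqI) (simp add: phi_star[OF A(1)])
    then show "compact_operator (\<phi> A o\<^sub>L t)"
      using compact_operator_compose_left[OF cA K[OF A(2)]] by simp
  qed
  moreover have "propagation_le \<AA> \<phi> t r"
    unfolding propagation_le_def
  proof (intro ballI impI)
    fix A A' assume A: "A \<in> \<AA>" "A' \<in> \<AA>" and far: "\<forall>a\<in>A. \<forall>a'\<in>A'. r < dist a' a"
    \<comment> \<open>A common point would share a piece with a point of \<open>A\<close>, at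
      distance at most \<open>r\<close>.\<close>
    have "A' \<inter> \<Union>(star A) = {}"
    proof (rule ccontr)
      assume "A' \<inter> \<Union>(star A) \<noteq> {}"
      then obtain a a' P where "P \<in> \<P>" "a' \<in> A'" "a' \<in> P" "a \<in> P" "a \<in> A"
        unfolding star_def by blast
      then show False using far dist_in_piece[of P a' a] by fastforce
    qed
    then have "\<phi> A' (\<phi> (\<Union>(star A)) x) = 0" for x
      by (intro phi_disjoint A Union_measurable star_subset)
    then have "\<phi> A' (t (\<phi> A x)) = 0" for x
      using t_phi[OF A(1), of x] by metis
    then show "\<phi> A' o\<^sub>L t o\<^sub>L \<phi> A = 0" by (intro blinfun_eqI) simp
  qed
  moreover have "t x = x" if "\<And>P. P \<in> \<P> \<Longrightarrow> \<phi> P x \<in> range (\<lambda>a. a *\<^sub>C v P)" for x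
    using that by (intro t_id) (auto simp: M_def L_def)
  ultimately show ?thesis using that t comm by blast
qed

text \<open>The union of \<open>star C\<close> is bounded and measurable, so cutting
  \<open>S\<close> down to it loses more than \<open>\<epsilon>\<close> on some vector of the unit
  ball. Strong convergence captures enough of the loss on finitely many pieces.\<close>

lemma escaping_mass:
  assumes far: "\<And>A. A \<in> \<AA> \<Longrightarrow> bounded A \<Longrightarrow> \<epsilon> < norm (S - (\<phi> A o\<^sub>L S))"
    and C: "bounded C" and \<epsilon>: "\<epsilon> > 0"
  shows "\<exists>w F. norm w \<le> 1 \<and> finite F \<and> F \<subseteq> \<P> - star C \<and> \<epsilon> < norm (\<phi> (\<Union>F) (S w))"
proof -
  let ?A = "\<Union>(star C)"
  have A: "?A \<in> \<AA>" by (intro Union_measurable star_subset)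
  have "\<exists>w. norm w \<le> 1 \<and> \<epsilon> < norm (S w - \<phi> ?A (S w))"
  proof (rule ccontr)
    assume "\<not> ?thesis"
    then have le: "norm ((S - (\<phi> ?A o\<^sub>L S)) w) \<le> \<epsilon>" if "norm w \<le> 1" for w
      using that by (force simp: blinfun.diff_left not_less[symmetric])
    have "norm (S - (\<phi> ?A o\<^sub>L S)) \<le> \<epsilon>"
    proof (rule norm_blinfun_bound)
      fix w
      show "norm ((S - (\<phi> ?A o\<^sub>L S)) w) \<le> \<epsilon> * norm w"
      proof (cases "w = 0")
        case False
        then show ?thesis using le[of "(1 / norm w) *\<^sub>R w"]
          by (simp add: blinfun.scaleR_right field_simps)
      qed simp
    qed (use \<epsilon> in simp)
    then show False using far[OF A bounded_Union_star[OF C]] by simp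
  qed
  then obtain w where w: "norm w \<le> 1" "\<epsilon> < norm (S w - \<phi> ?A (S w))" by blast
  define z where "z = S w - \<phi> ?A (S w)"
  \<comment> \<open>The tolerance is half the excess of \<open>norm z\<close> over
    \<open>\<epsilon>\<close>, so the partial sum still has norm above
    \<open>\<epsilon>\<close>.\<close>
  obtain F0 where F0: "finite F0" "F0 \<subseteq> \<P>" "dist (\<Sum>P\<in>F0. \<phi> P z) z \<le> (norm z - \<epsilon>) / 2"
    using has_sum_finite_approximation[OF pieces_sum, of "(norm z - \<epsilon>) / 2" z] w(2)
    by (auto simp: z_def)
  define F where "F = F0 - star C"
  have F: "finite F" "F \<subseteq> \<P> - star C" "F \<subseteq> \<P>" using F0 by (auto simp: F_def)
  have phi_z: "\<phi> P z = (if P \<in> star C then 0 else \<phi> P (S w))" if "P \<in> \<P>" for P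
    using that by (simp add: z_def blinfun.diff_right phi_piece_Union star_subset)
  have "(\<Sum>P\<in>F0. \<phi> P z) = (\<Sum>P\<in>F. \<phi> P (S w))"
    unfolding F_def using F0 by (intro sum.mono_neutral_cong_right) (auto simp: phi_z)
  also have "\<dots> = (\<Sum>P\<in>F. \<phi> P (\<phi> (\<Union>F) (S w)))"
    by (intro sum.cong refl) (simp add: phi_piece_Union F(3) subsetD[OF F(3)])
  also have "\<dots> = \<phi> (\<Union>F) (S w)"
    by (rule eq_finite_sum_of_pieces[symmetric]) (use F in \<open>auto simp: phi_piece_Union\<close>)
  finally have "dist (\<phi> (\<Union>F) (S w)) z \<le> (norm z - \<epsilon>) / 2" using F0(3) by simp
  moreover have "norm z \<le> norm (\<phi> (\<Union>F) (S w)) + dist (\<phi> (\<Union>F) (S w)) z"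
    by (metis dist_commute dist_norm norm_triangle_sub)
  ultimately have "\<epsilon> < norm (\<phi> (\<Union>F) (S w))" using w(2) by (simp add: z_def)
  then show ?thesis using w(1) F by blast
qed

text \<open>Otherwise choose unit vectors \<open>w n\<close> and disjoint finite families \<open>F n\<close> of pieces escaping to
  infinity that carry a definite part of \<open>S (w n)\<close>. For the block projection \<open>t\<close> built from these
  components, \<open>t (S (w n))\<close> still carries that part on \<open>F n\<close>, so it has no Cauchy subsequence.\<close>

lemma ex_bounded_approximate_support:
  fixes S :: "'k::real_normed_vector \<Rightarrow>\<^sub>L 'h"
  assumes cauchy: "\<And>t w. is_projection t \<Longrightarrow> locally_compact_op \<AA> \<phi> t \<Longrightarrow> propagation_le \<AA> \<phi> t r \<Longrightarrow>
      (\<And>n. norm (w n) \<le> 1) \<Longrightarrow> \<exists>s. strict_mono (s :: nat \<Rightarrow> nat) \<and> Cauchy (\<lambda>n. t (S (w (s n))))"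
    and \<epsilon>: "\<epsilon> > 0"
  shows "\<exists>A\<in>\<AA>. bounded A \<and> norm (S - (\<phi> A o\<^sub>L S)) \<le> \<epsilon>"
proof (rule ccontr)
  assume "\<not> ?thesis"
  then have far: "\<epsilon> < norm (S - (\<phi> A o\<^sub>L S))" if "A \<in> \<AA>" "bounded A" for A
    using that by (auto simp: not_le)
  \<comment> \<open>Any base point serves as centre of the exhausting balls.\<close>
  define x0 :: 'x where "x0 = undefined"
  \<comment> \<open>At stage \<open>n\<close>, \<open>C\<close> is the bounded set to avoid,
    \<open>w\<close> the test vector and \<open>F\<close> the pieces carrying its mass. The ball
    inside \<open>C\<close> drives the pieces out of every bounded set.\<close>
  define good where "good n z \<longleftrightarrow> (case z of (C, w, F) \<Rightarrow> bounded C \<and> cball x0 (real n) \<subseteq> C \<and>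
      norm w \<le> 1 \<and> finite F \<and> F \<subseteq> \<P> - star C \<and> \<epsilon> < norm (\<phi> (\<Union>F) (S w)))" for n z
  \<comment> \<open>The next set to avoid swallows the present one and the pieces just used, which
    makes the families disjoint.\<close>
  define ext where "ext z z' \<longleftrightarrow> fst z \<union> \<Union>(snd (snd z)) \<subseteq> (fst z' :: 'x set)"
    for z z' :: "'x set \<times> 'k \<times> 'x set set"
  have step: "\<exists>z. good n z \<and> D \<subseteq> fst z" if D: "bounded D" for n D
  proof -
    have C: "bounded (D \<union> cball x0 (real n))" using D by simp
    obtain w F where "norm w \<le> 1" "finite F" "F \<subseteq> \<P> - star (D \<union> cball x0 (real n))"
      "\<epsilon> < norm (\<phi> (\<Union>F) (S w))"
      using escaping_mass[OF far C \<epsilon>] by blast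
    then have "good n (D \<union> cball x0 (real n), w, F)" unfolding good_def using C by simp
    then show ?thesis by (intro exI[of _ "(D \<union> cball x0 (real n), w, F)"]) simp
  qed
  have bounded_pieces: "bounded (\<Union>F)" if "finite F" "F \<subseteq> \<P>" for F
    using that piece_diam by (intro bounded_Union) (auto simp: diam_le_def)
  have "\<exists>f. \<forall>n. good n (f n) \<and> ext (f n) (f (Suc n))"
  proof (rule dependent_nat_choice)
    show "\<exists>z. good 0 z" using step[OF bounded_empty] by blast
    fix z n assume z: "good n z"
    obtain C w F where zz: "z = (C, w, F)" by (cases z)
    have "bounded (fst z \<union> \<Union>(snd (snd z)))"
      using z bounded_pieces[of F] by (auto simp: good_def zz)
    from step[OF this] show "\<exists>z'. good (Suc n) z' \<and> ext z z'" unfolding ext_def .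
  qed
  then obtain f where f: "\<And>n. good n (f n)" "\<And>n. ext (f n) (f (Suc n))" by blast
  define C where "C n = fst (f n)" for n
  define w where "w n = fst (snd (f n))" for n
  define F where "F n = snd (snd (f n))" for n
  have fn: "f n = (C n, w n, F n)" for n by (simp add: C_def w_def F_def)
  have props: "cball x0 (real n) \<subseteq> C n" "norm (w n) \<le> 1" "finite (F n)" "F n \<subseteq> \<P> - star (C n)"
    "\<epsilon> < norm (\<phi> (\<Union>(F n)) (S (w n)))" for n
    using f(1)[of n] by (simp_all add: good_def fn)
  have F_pieces: "F n \<subseteq> \<P>" for n using props(4) by blast
  have step_C: "C n \<subseteq> C (Suc n)" "\<Union>(F n) \<subseteq> C (Suc n)" for n
    using f(2)[of n] by (auto simp: ext_def fn)
  have mono_C: "C m \<subseteq> C n" if "m \<le> n" for m n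
    using that step_C(1) by (rule lift_Suc_mono_le[rotated])
  have disj: "F m \<inter> F n = {}" if "m < n" for m n
  proof (rule ccontr)
    assume "F m \<inter> F n \<noteq> {}"
    then obtain P where P: "P \<in> F m" "P \<in> F n" by blast
    have "P \<subseteq> C (Suc m)" using P(1) step_C(2) by blast
    also have "\<dots> \<subseteq> C n" using that by (intro mono_C) simp
    finally have "P \<inter> C n \<noteq> {}" using piece_nonempty[of P] F_pieces P by blast
    then show False using P(2) props(4)[of n] by (auto simp: star_def)
  qed
  have F_inj: "m = n" if "P \<in> F m" "P \<in> F n" for P m n
    using disj[of m n] disj[of n m] that by (cases m n rule: linorder_cases) auto
  define v where "v P = (if \<exists>n. P \<in> F n then \<phi> P (S (w (THE n. P \<in> F n))) else 0)" for P
  have v_in: "v P = \<phi> P (S (w n))" if "P \<in> F n" for P n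
  proof -
    have "(THE n. P \<in> F n) = n" using that F_inj by blast
    then show ?thesis using that by (auto simp: v_def)
  qed
  have eventually_avoid: "\<exists>N. \<forall>n\<ge>N. F n \<inter> star D = {}" if D: "bounded D" for D
  proof -
    obtain N where N: "\<And>n. n \<ge> N \<Longrightarrow> D \<subseteq> C n"
      using bounded_eventually_subset[OF D props(1)] by blast
    have "F n \<inter> star D = {}" if "n \<ge> N" for n
      using N[OF that] props(4)[of n] by (auto simp: star_def)
    then show ?thesis by blast
  qed
  have locfin: "finite {P \<in> star D. v P \<noteq> 0}" if D: "bounded D" for D
  proof -
    obtain N where N: "\<And>n. n \<ge> N \<Longrightarrow> F n \<inter> star D = {}" using eventually_avoid[OF D] by blast
    \<comment> \<open>Families of index at least \<open>N\<close> miss the star, and each earlier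
      family is finite.\<close>
    have "{P \<in> star D. v P \<noteq> 0} \<subseteq> (\<Union>n<N. F n)"
    proof clarify
      fix P assume P: "P \<in> star D" "v P \<noteq> 0"
      then obtain n where n: "P \<in> F n" unfolding v_def by presburger
      then have "n < N" using N[of n] P(1) by (force simp: not_le[symmetric])
      with n show "P \<in> (\<Union>n<N. F n)" by blast
    qed
    then show ?thesis by (rule finite_subset) (use props(3) in blast)
  qed
  obtain t where t: "is_projection t" "locally_compact_op \<AA> \<phi> t" "propagation_le \<AA> \<phi> t r"
    and t_id: "\<And>x. (\<And>P. P \<in> \<P> \<Longrightarrow> \<phi> P x \<in> range (\<lambda>a. a *\<^sub>C v P)) \<Longrightarrow> t x = x"
    and comm: "\<And>Q x. Q \<subseteq> \<P> \<Longrightarrow> t (\<phi> (\<Union>Q) x) = \<phi> (\<Union>Q) (t x)"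
    using block_rank_one_projection[OF locfin] by blast
  define y where "y n = t (S (w n))" for n
  \<comment> \<open>The truncated vector has its components in the prescribed lines, so
    \<open>t\<close> fixes it; commuting \<open>t\<close> with the truncation gives the claim for
    \<open>y n\<close>.\<close>
  have phi_y: "\<phi> (\<Union>(F n)) (y n) = \<phi> (\<Union>(F n)) (S (w n))" for n
  proof -
    have "\<phi> P (\<phi> (\<Union>(F n)) (S (w n))) \<in> range (\<lambda>a. a *\<^sub>C v P)" if "P \<in> \<P>" for P
    proof (cases "P \<in> F n")
      case True
      have "\<phi> P (\<phi> (\<Union>(F n)) (S (w n))) = 1 *\<^sub>C v P"
        using True by (simp add: phi_piece_Union that F_pieces v_in scaleR_scaleC[of 1, simplified, symmetric])
      then show ?thesis by (rule range_eqI)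
    next
      case False
      then have "\<phi> P (\<phi> (\<Union>(F n)) (S (w n))) = 0 *\<^sub>C v P"
        by (simp add: phi_piece_Union that F_pieces)
      then show ?thesis by (rule range_eqI)
    qed
    then have "t (\<phi> (\<Union>(F n)) (S (w n))) = \<phi> (\<Union>(F n)) (S (w n))" by (rule t_id)
    then show ?thesis by (simp add: comm[OF F_pieces] y_def)
  qed
  obtain s where s: "strict_mono s" "Cauchy (\<lambda>n. y (s n))"
    using cauchy[OF t, of w] props(2) unfolding y_def by blast
  then obtain N where N: "\<And>n. n \<ge> N \<Longrightarrow> dist (y (s n)) (y (s N)) < \<epsilon> / 2"
    unfolding Cauchy_def using \<epsilon> by (metis half_gt_zero order_refl)
  \<comment> \<open>Finitely many pieces carry \<open>y (s N)\<close> up to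
    \<open>\<epsilon> / 2\<close>; their union is bounded, so late families avoid them.\<close>
  obtain F0 where F0: "finite F0" "F0 \<subseteq> \<P>" "dist (\<Sum>P\<in>F0. \<phi> P (y (s N))) (y (s N)) \<le> \<epsilon> / 2"
    using has_sum_finite_approximation[OF pieces_sum, of "\<epsilon> / 2" "y (s N)"] \<epsilon> by auto
  obtain N' where N': "\<And>n. n \<ge> N' \<Longrightarrow> F n \<inter> star (\<Union>F0) = {}"
    using eventually_avoid[OF bounded_pieces[OF F0(1,2)]] by blast
  \<comment> \<open>Late enough for the Cauchy estimate and, since \<open>s n \<ge> n\<close>, for
    avoiding \<open>F0\<close>.\<close>
  define n where "n = max N N'"
  have sn: "s n \<ge> N'" using seq_suble[OF s(1), of n] by (simp add: n_def)
  let ?p = "\<phi> (\<Union>(F (s n)))"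
  have p: "is_projection ?p" by (intro proj Union_measurable F_pieces)
  have "F0 \<subseteq> star (\<Union>F0)" using F0(2) piece_nonempty by (auto simp: star_def)
  then have "F0 \<inter> F (s n) = {}" using N'[OF sn] by blast
  have "?p (\<phi> P u) = 0" if P: "P \<in> F0" for P u
  proof (rule phi_disjoint)
    have "P \<in> \<P>" "P \<notin> F (s n)" using P F0(2) \<open>F0 \<inter> F (s n) = {}\<close> by auto
    then show "P \<in> \<AA>" "\<Union>(F (s n)) \<inter> P = {}"
      using piece_Int_Union[OF _ F_pieces, of P "s n"] by (simp_all add: piece_measurable Int_commute)
  qed (intro Union_measurable F_pieces)
  then have "?p (\<Sum>P\<in>F0. \<phi> P (y (s N))) = 0" by (simp add: blinfun.sum_right)
  then have "norm (?p (y (s N))) = norm (?p (y (s N) - (\<Sum>P\<in>F0. \<phi> P (y (s N)))))"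
    by (simp add: blinfun.diff_right)
  also have "\<dots> \<le> \<epsilon> / 2"
    using norm_projection_le[OF p, of "y (s N) - (\<Sum>P\<in>F0. \<phi> P (y (s N)))"] F0(3)
    by (simp add: dist_norm norm_minus_commute)
  finally have 1: "norm (?p (y (s N))) \<le> \<epsilon> / 2" .
  have 2: "norm (?p (y (s n) - y (s N))) < \<epsilon> / 2"
    using norm_projection_le[OF p, of "y (s n) - y (s N)"] N[of n] by (simp add: dist_norm n_def)
  \<comment> \<open>The mass on \<open>F (s n)\<close> exceeds \<open>\<epsilon>\<close>, while the
    part from \<open>y (s N)\<close> and the Cauchy difference contribute at most
    \<open>\<epsilon> / 2\<close> each.\<close>
  have "\<epsilon> < norm (?p (y (s n)))" using props(5) phi_y by simp
  also have "?p (y (s n)) = ?p (y (s N)) + ?p (y (s n) - y (s N))" by (simp add: blinfun.diff_right)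
  also have "norm \<dots> \<le> norm (?p (y (s N))) + norm (?p (y (s n) - y (s N)))"
    by (rule norm_triangle_ineq)
  finally show False using 1 2 by linarith
qed

end

text \<open>The subsequence hypothesis of \<open>ex_bounded_approximate_support\<close> holds for
  \<open>cadjoint T o\<^sub>L \<psi> B\<close>: the projections \<open>t\<close> in question lie in
  the Roe algebra, so local compactness of \<open>Ad T t\<close> provides a compact Gram
  operator.\<close>

lemma Roe_locally_compact_imp_quasi_proper:
  fixes \<AA> :: "'x::metric_space set set"
    and \<phi> :: "'x set \<Rightarrow> 'h::chilbert_space \<Rightarrow>\<^sub>L 'h"
    and T :: "'h \<Rightarrow>\<^sub>L 'k::chilbert_space"
  assumes X: "metric_module \<AA> \<phi>" and Y: "metric_module \<BB> \<psi>"
    and disc: "discrete_module \<AA> \<phi>" and T: "cblinop T"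
    and Ad: "\<forall>t\<in>Roe_algebra \<AA> \<phi>. locally_compact_op \<BB> \<psi> (Ad T t)"
  shows "quasi_proper \<AA> \<phi> \<BB> \<psi> T"
  unfolding quasi_proper_def
proof (intro allI impI ballI)
  obtain r \<P> where "discrete_partition \<AA> \<phi> r \<P>"
    using X disc unfolding discrete_module_def discrete_partition_def by blast
  then interpret discrete_partition \<AA> \<phi> r \<P> .
  fix \<epsilon> :: real and B assume \<epsilon>: "\<epsilon> > 0" and B: "B \<in> \<BB>" "bounded B"
  have pB: "is_projection (\<psi> B)" using metric_module_projection[OF Y] B by simp
  let ?S = "cadjoint T o\<^sub>L \<psi> B"
  have "\<exists>s. strict_mono (s :: nat \<Rightarrow> nat) \<and> Cauchy (\<lambda>n. t (?S (w (s n))))"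
    if t: "is_projection t" "locally_compact_op \<AA> \<phi> t" "propagation_le \<AA> \<phi> t r"
      and w: "\<And>n. norm (w n) \<le> 1" for t w
  proof -
    have "t \<in> Roe_algebra \<AA> \<phi>"
      unfolding Roe_algebra_def
      by (rule subsetD[OF closure_subset]) (use t in \<open>auto simp: finite_propagation_def\<close>)
    then have "compact_operator (Ad T t o\<^sub>L \<psi> B)"
      using Ad B by (auto simp: locally_compact_op_def)
    then have K: "compact_operator (\<psi> B o\<^sub>L (Ad T t o\<^sub>L \<psi> B))"
      by (rule compact_operator_compose_left[OF is_projectionD(1)[OF pB]])
    \<comment> \<open>\<open>t\<close> is self-adjoint and idempotent, so one of its two copies
      drops out.\<close>
    have gram: "inner ((t o\<^sub>L ?S) x) ((t o\<^sub>L ?S) y) = inner x ((\<psi> B o\<^sub>L (Ad T t o\<^sub>L \<psi> B)) y)" for x y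
    proof -
      have "inner ((t o\<^sub>L ?S) x) ((t o\<^sub>L ?S) y) = inner (?S x) (t (?S y))"
        by (simp add: is_projectionD(2,3)[OF t(1)])
      also have "\<dots> = inner (\<psi> B x) (T (t (?S y)))"
        using inner_cadjoint[OF T, of "t (?S y)" "\<psi> B x"] by (simp add: inner_commute)
      also have "\<dots> = inner x (\<psi> B (T (t (?S y))))" by (rule is_projectionD(3)[OF pB])
      finally show ?thesis by (simp add: Ad_def)
    qed
    show ?thesis using Cauchy_subseq_of_compact_gram[OF K gram w] by simp
  qed
  then have approx: "\<exists>A\<in>\<AA>. bounded A \<and> norm (?S - (\<phi> A o\<^sub>L ?S)) \<le> \<epsilon>"
    using \<epsilon> by (rule ex_bounded_approximate_support)
  have assoc: "\<phi> A o\<^sub>L cadjoint T o\<^sub>L \<psi> B = \<phi> A o\<^sub>L ?S" for A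
    by (rule blinfun_eqI) simp
  show "\<exists>A\<in>\<AA>. bounded A \<and> norm ((cadjoint T o\<^sub>L \<psi> B) - (\<phi> A o\<^sub>L cadjoint T o\<^sub>L \<psi> B)) \<le> \<epsilon>"
    unfolding assoc by (rule approx)
qed

theorem theoremL:
  fixes \<AA> :: "'x::metric_space set set"
    and \<phi> :: "'x set \<Rightarrow> 'h::chilbert_space \<Rightarrow>\<^sub>L 'h"
    and \<BB> :: "'y::metric_space set set"
    and \<psi> :: "'y set \<Rightarrow> 'k::chilbert_space \<Rightarrow>\<^sub>L 'k"
    and T :: "'h \<Rightarrow>\<^sub>L 'k"
  assumes "\<forall>(x::'x) r. compact (cball x r)"
    and "\<forall>(y::'y) r. compact (cball y r)"
    and "metric_module \<AA> \<phi>"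
    and "metric_module \<BB> \<psi>"
    and "discrete_module \<AA> \<phi>"
    and "cblinop T"
  shows "((\<forall>t. locally_compact_op \<AA> \<phi> t \<longrightarrow> locally_compact_op \<BB> \<psi> (Ad T t)) \<longleftrightarrow>
          (\<forall>t\<in>Roe_algebra \<AA> \<phi>. locally_compact_op \<BB> \<psi> (Ad T t))) \<and>
         ((\<forall>t\<in>Roe_algebra \<AA> \<phi>. locally_compact_op \<BB> \<psi> (Ad T t)) \<longleftrightarrow>
          quasi_proper \<AA> \<phi> \<BB> \<psi> T)"
  \<comment> \<open>The three facts give (1) to (2), (2) to (3) and (3) to (1), closing the
    cycle.\<close>
  using Roe_algebra_locally_compact[OF assms(3)]
    Roe_locally_compact_imp_quasi_proper[OF assms(3-6)]
    quasi_proper_imp_Ad_locally_compact[OF assms(3,4,6)]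
  by blast

end
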